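(* Let $G$ be a semitopological group. Every wap (not necessarily compact or metrizable) $G$-flow $X$ is locally equicontinuous ($X\in\mathrm{LE}$), and every $G$-quasiminimal subflow of $X$ is equicontinuous.
   Context: A semitopological group is a group with a topology for which multiplication is separately continuous. A $G$-flow is a topological space $X$ with a separately continuous left action $G\times X\to X$ (the identity acts as the identity). $C(X)$ is the Banach algebra of bounded continuous real functions on $X$ with the sup norm; $(fg)(x)=f(gx)$, $fG=\{fg:g\in G\}$. $\mathrm{WAP}_G(X)$ is the set of $f\in C(X)$ such that $fG$ is relatively weakly compact in $C(X)$. $X$ is wap if $\mathrm{WAP}_G(X)$ separates points and closed subsets of $X$ (it separates the points of $X$, and for every closed $F\subset X$ and $x\notin F$ there is $f\in\mathrm{WAP}_G(X)$ with $f(x)\notin\overline{f(F)}$). A uniformity $\mu$ on a flow $X$ is compatible if it induces the topology of $X$. A point $z\in X$ is a point of $\mu$-equicontinuity of $(G,X)$ if for every $\varepsilon\in\mu$ there is a neighborhood $U$ of $z$ in $X$ with $(gx,gz)\in\varepsilon$ for all $x\in U$, $g\in G$. A flow is equicontinuous if for some compatible uniformity $\mu$ every point is a point of $\mu$-equicontinuity. $X\in\mathrm{LE}$ if there is a compatible uniformity $\mu$ on $X$ such that every $z\in X$ is a point of $\mu|_{\overline{Gz}}$-equicontinuity of the subflow $(G,\overline{Gz})$, where $\overline{Gz}$ is the closure of the orbit in $X$. A $G$-flow $Y$ (in particular a $G$-invariant subspace of $X$ with the relative topology) is quasiminimal if for every $y\in Y$ the closure of $Gy$ in $Y$ has nonempty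 interior in $Y$. *)

theory Defs
  imports "HOL-Analysis.Analysis" "HOL-Algebra.Group_Action"
begin

section \<open>Semitopological groups and flows\<close>

locale semitopological_group = group G for G (structure) +
  fixes TG :: "'g topology"
  assumes topspace_TG: "topspace TG = carrier G"
    and continuous_left_mult: "g \<in> carrier G \<Longrightarrow> continuous_map TG TG (\<lambda>h. g \<otimes> h)"
    and continuous_right_mult: "g \<in> carrier G \<Longrightarrow> continuous_map TG TG (\<lambda>h. h \<otimes> g)"

text \<open>The phase space is the whole type, so that the Banach space \<open>C(X)\<close> is the library type
  \<open>'x \<Rightarrow>\<^sub>C real\<close>. Subflows are given by invariant subsets with the subspace topology.\<close>

locale flow = semitopological_group G TG + group_action G UNIV act
  for G (structure) and TG :: "'g topology" and act :: "'g \<Rightarrow> 'x::topological_space \<Rightarrow> 'x" +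
  assumes continuous_act_space: "g \<in> carrier G \<Longrightarrow> continuous_on UNIV (act g)"
    and continuous_act_group: "continuous_map TG euclidean (\<lambda>g. act g x)"

definition invariant_subset :: "('g, 'm) monoid_scheme \<Rightarrow> ('g \<Rightarrow> 'x \<Rightarrow> 'x) \<Rightarrow> 'x set \<Rightarrow> bool" where
  "invariant_subset G act Y \<longleftrightarrow> (\<forall>g\<in>carrier G. \<forall>y\<in>Y. act g y \<in> Y)"


section \<open>Weakly almost periodic functions\<close>

definition weak_topology :: "'a::real_normed_vector topology" where
  "weak_topology = topology_generated_by
     {blinfun_apply \<phi> -` U | (\<phi> :: 'a \<Rightarrow>\<^sub>L real) U. open U}"

lemma topspace_weak_topology [simp]: "topspace weak_topology = UNIV"
proof -
  have "blinfun_apply (0 :: 'a \<Rightarrow>\<^sub>L real) -` UNIV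
      \<in> {blinfun_apply \<phi> -` U | (\<phi> :: 'a \<Rightarrow>\<^sub>L real) U. open U}"
    by blast
  then show ?thesis
    unfolding weak_topology_def topology_generated_by_topspace by auto
qed

definition relatively_weakly_compact :: "'a::real_normed_vector set \<Rightarrow> bool" where
  "relatively_weakly_compact A \<longleftrightarrow> compactin weak_topology (weak_topology closure_of A)"

text \<open>The function \<open>fg\<close> given by \<open>(fg)(x) = f(gx)\<close>. The coercion \<open>Bcontfun\<close> is meaningful only
  when \<open>act g\<close> is continuous, which holds in a flow; see \<open>apply_translate\<close>.\<close>

definition translate ::
  "('g \<Rightarrow> 'x \<Rightarrow> 'x) \<Rightarrow> ('x::topological_space \<Rightarrow>\<^sub>C real) \<Rightarrow> 'g \<Rightarrow> ('x \<Rightarrow>\<^sub>C real)" where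
  "translate act f g = Bcontfun (\<lambda>x. apply_bcontfun f (act g x))"

lemma (in flow) apply_translate:
  assumes "g \<in> carrier G"
  shows "apply_bcontfun (translate act f g) x = apply_bcontfun f (act g x)"
proof -
  have "continuous_on UNIV (\<lambda>x. apply_bcontfun f (act g x))"
    by (rule continuous_on_compose2[OF continuous_on_apply_bcontfun[of UNIV f]
          continuous_act_space[OF assms]]) auto
  moreover have "bounded (range (\<lambda>x. apply_bcontfun f (act g x)))"
    by (rule bounded_subset[OF bounded_apply_bcontfun[of f]]) auto
  ultimately have "(\<lambda>x. apply_bcontfun f (act g x)) \<in> bcontfun"
    by (simp add: bcontfun_def)
  then show ?thesis
    by (simp add: translate_def Bcontfun_inverse)
qed

definition WAP ::
  "('g, 'm) monoid_scheme \<Rightarrow> ('g \<Rightarrow> 'x \<Rightarrow> 'x) \<Rightarrow> ('x::topological_space \<Rightarrow>\<^sub>C real) set" where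
  "WAP G act = {f. relatively_weakly_compact (translate act f ` carrier G)}"

definition separates_points_and_closed_sets :: "('x::topological_space \<Rightarrow>\<^sub>C real) set \<Rightarrow> bool" where
  "separates_points_and_closed_sets A \<longleftrightarrow>
     (\<forall>x y. x \<noteq> y \<longrightarrow> (\<exists>f\<in>A. apply_bcontfun f x \<noteq> apply_bcontfun f y)) \<and>
     (\<forall>F x. closed F \<and> x \<notin> F \<longrightarrow>
        (\<exists>f\<in>A. apply_bcontfun f x \<notin> closure (apply_bcontfun f ` F)))"

definition wap :: "('g, 'm) monoid_scheme \<Rightarrow> ('g \<Rightarrow> 'x::topological_space \<Rightarrow> 'x) \<Rightarrow> bool" where
  "wap G act \<longleftrightarrow> separates_points_and_closed_sets (WAP G act)"


section \<open>Uniformities\<close>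

text \<open>A uniformity on a set \<open>Y\<close> is a filter concentrated on \<open>Y \<times> Y\<close>, as in the class
  \<open>uniform_space\<close>; its entourages are the predicates that hold eventually.\<close>

definition uniformity_of :: "'x set \<Rightarrow> ('x \<times> 'x) filter \<Rightarrow> bool" where
  "uniformity_of Y \<mu> \<longleftrightarrow>
     \<mu> \<le> principal (Y \<times> Y) \<and>
     (\<forall>E. eventually E \<mu> \<longrightarrow>
        (\<forall>x\<in>Y. E (x, x)) \<and>
        eventually (\<lambda>(x, y). E (y, x)) \<mu> \<and>
        (\<exists>D. eventually D \<mu> \<and> (\<forall>x y z. D (x, y) \<longrightarrow> D (y, z) \<longrightarrow> E (x, z))))"

definition compatible_uniformity :: "'x topology \<Rightarrow> ('x \<times> 'x) filter \<Rightarrow> bool" where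
  "compatible_uniformity T \<mu> \<longleftrightarrow>
     uniformity_of (topspace T) \<mu> \<and>
     (\<forall>U. openin T U \<longleftrightarrow>
        U \<subseteq> topspace T \<and> (\<forall>x\<in>U. eventually (\<lambda>(x', y). x' = x \<longrightarrow> y \<in> U) \<mu>))"

definition restrict_uniformity :: "('x \<times> 'x) filter \<Rightarrow> 'x set \<Rightarrow> ('x \<times> 'x) filter" where
  "restrict_uniformity \<mu> Z = inf \<mu> (principal (Z \<times> Z))"


section \<open>Equicontinuity, local equicontinuity, quasiminimality\<close>

text \<open>Below, \<open>T\<close> is the topology of a flow, possibly of a subflow; its underlying set is
  \<open>topspace T\<close>.\<close>

definition equicontinuity_point ::
  "('g, 'm) monoid_scheme \<Rightarrow> ('g \<Rightarrow> 'x \<Rightarrow> 'x) \<Rightarrow> 'x topology \<Rightarrow> ('x \<times> 'x) filter \<Rightarrow> 'x \<Rightarrow> bool" where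
  "equicontinuity_point G act T \<mu> z \<longleftrightarrow>
     (\<forall>E. eventually E \<mu> \<longrightarrow>
        (\<exists>U. openin T U \<and> z \<in> U \<and> (\<forall>x\<in>U. \<forall>g\<in>carrier G. E (act g x, act g z))))"

definition equicontinuous_flow ::
  "('g, 'm) monoid_scheme \<Rightarrow> ('g \<Rightarrow> 'x \<Rightarrow> 'x) \<Rightarrow> 'x topology \<Rightarrow> bool" where
  "equicontinuous_flow G act T \<longleftrightarrow>
     (\<exists>\<mu>. compatible_uniformity T \<mu> \<and> (\<forall>z\<in>topspace T. equicontinuity_point G act T \<mu> z))"

definition locally_equicontinuous_flow ::
  "('g, 'm) monoid_scheme \<Rightarrow> ('g \<Rightarrow> 'x \<Rightarrow> 'x) \<Rightarrow> 'x topology \<Rightarrow> bool" where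
  "locally_equicontinuous_flow G act T \<longleftrightarrow>
     (\<exists>\<mu>. compatible_uniformity T \<mu> \<and>
        (\<forall>z\<in>topspace T.
           let Z = T closure_of orbit G act z in
             equicontinuity_point G act (subtopology T Z) (restrict_uniformity \<mu> Z) z))"

definition quasiminimal ::
  "('g, 'm) monoid_scheme \<Rightarrow> ('g \<Rightarrow> 'x \<Rightarrow> 'x) \<Rightarrow> 'x topology \<Rightarrow> bool" where
  "quasiminimal G act T \<longleftrightarrow>
     (\<forall>y\<in>topspace T. T interior_of (T closure_of orbit G act y) \<noteq> {})"

end

theory Submission
  imports Defs
begin

text \<open>Let \<open>A\<close> be a relatively weakly compact set of bounded continuous functions on \<open>X\<close>. The
  key point is that every nonempty \<open>D\<close> has nonempty relatively open pieces on which all members of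
  \<open>A\<close> oscillate uniformly little. If this fails, one builds inductively \<open>a n, b n \<in> A\<close> and points
  \<open>x n \<in> D\<close> with \<open>\<bar>a n - b n\<bar> < 1/n\<close> at \<open>x m\<close> for \<open>m < n\<close> but \<open>> \<epsilon>\<close> for \<open>m \<ge> n\<close>; a weak cluster
  point of \<open>(a n, b n)\<close> and a cluster functional of the evaluations at \<open>x n\<close> are then
  incompatible. For \<open>A = fG\<close> and \<open>D = Gz\<close>, the small oscillation passes from the orbit to its
  closure, and since \<open>G\<close> is a group the open piece can be moved back to \<open>z\<close>. Hence \<open>z\<close> is a point
  of equicontinuity in its orbit closure for the uniformity generated by the weakly almost
  periodic functions; in the quasiminimal case the orbit closures are neighborhoods.\<close>

section \<open>Oscillation of relatively weakly compact sets of functions\<close>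

text \<open>Closed sets containing a tail of \<open>s\<close> have the finite intersection property
  inside \<open>S\<close>. Compactness alone gives cluster points, not convergent subsequences, so
  limits are expressed below by closed conditions that hold on a tail.\<close>

lemma compactin_cluster_point:
  assumes S: "compactin T S" and s: "\<And>n::nat. s n \<in> S"
  obtains x where "x \<in> S" "\<And>C n. closedin T C \<Longrightarrow> (\<And>i. i \<ge> n \<Longrightarrow> s i \<in> C) \<Longrightarrow> x \<in> C"
proof -
  define \<C> where "\<C> = {C. closedin T C \<and> (\<exists>n. \<forall>i\<ge>n. s i \<in> C)}"
  have "S \<inter> \<Inter>\<F> \<noteq> {}" if "finite \<F>" "\<F> \<subseteq> \<C>" for \<F>
  proof -
    have "eventually (\<lambda>i. \<forall>C\<in>\<F>. s i \<in> C) sequentially"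
      using that by (intro eventually_ball_finite) (auto simp: eventually_sequentially \<C>_def)
    then obtain n where "\<forall>C\<in>\<F>. s n \<in> C"
      by (auto simp: eventually_sequentially)
    with s show ?thesis by blast
  qed
  moreover have "\<forall>C\<in>\<C>. closedin T C" by (simp add: \<C>_def)
  ultimately have "S \<inter> \<Inter>\<C> \<noteq> {}"
    using S unfolding compactin_fip by blast
  then obtain x where x: "x \<in> S" "x \<in> \<Inter>\<C>" by blast
  show thesis
  proof (rule that)
    fix C n assume "closedin T C" "\<And>i. i \<ge> n \<Longrightarrow> s i \<in> C"
    then have "C \<in> \<C>" by (auto simp: \<C>_def)
    with x show "x \<in> C" by blast
  qed (fact x(1))
qed

lemma continuous_map_weak_topology:
  assumes "bounded_linear \<phi>"
  shows "continuous_map weak_topology euclideanreal \<phi>"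
proof -
  have "openin weak_topology (\<phi> -` U)" if "open U" for U
  proof -
    have "\<phi> -` U = blinfun_apply (Blinfun \<phi>) -` U"
      by (simp add: bounded_linear_Blinfun_apply[OF assms])
    with that show ?thesis
      unfolding weak_topology_def by (intro topology_generated_by_Basis) blast
  qed
  then show ?thesis
    by (auto simp: continuous_map_def vimage_def)
qed

lemma bounded_linear_apply_bcontfun:
  "bounded_linear (\<lambda>f :: 'x::topological_space \<Rightarrow>\<^sub>C real. apply_bcontfun f x)"
  by (rule bounded_linear_intro[where K = 1])
     (use norm_bounded[of _ x] in \<open>auto simp flip: real_norm_def\<close>)

text \<open>As in Banach-Alaoglu: the evaluations lie in a product of balls, compact by Tychonoff;
  additivity and homogeneity are closed conditions and pass to a cluster point.\<close>

lemma cluster_functional: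
  fixes x :: "nat \<Rightarrow> 'x::topological_space"
  obtains \<psi> :: "('x \<Rightarrow>\<^sub>C real) \<Rightarrow> real" where "bounded_linear \<psi>"
    "\<And>C f n. closed C \<Longrightarrow> (\<And>m. m \<ge> n \<Longrightarrow> apply_bcontfun f (x m) \<in> C) \<Longrightarrow> \<psi> f \<in> C"
proof -
  define S :: "(('x \<Rightarrow>\<^sub>C real) \<Rightarrow> real) set" where "S = (\<Pi>\<^sub>E f\<in>UNIV. cball 0 (norm f))"
  have "compactin euclidean S"
    unfolding S_def euclidean_product_topology[symmetric] by (simp add: compactin_PiE)
  moreover have "(\<lambda>f. apply_bcontfun f (x m)) \<in> S" for m
    using norm_bounded[of _ "x m"] by (auto simp: S_def PiE_def simp flip: real_norm_def)
  ultimately obtain \<psi> where \<psi>: "\<psi> \<in> S" and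
    cl: "\<And>C n. closed C \<Longrightarrow> (\<And>m. m \<ge> n \<Longrightarrow> (\<lambda>f. apply_bcontfun f (x m)) \<in> C) \<Longrightarrow> \<psi> \<in> C"
    using compactin_cluster_point[of euclidean S "\<lambda>m f. apply_bcontfun f (x m)"] by auto
  show thesis
  proof
    show "bounded_linear \<psi>"
    proof (rule bounded_linear_intro[where K = 1])
      fix f g :: "'x \<Rightarrow>\<^sub>C real" and r :: real
      have "closed {\<phi> :: ('x \<Rightarrow>\<^sub>C real) \<Rightarrow> real. \<phi> (f + g) = \<phi> f + \<phi> g}"
        by (intro closed_Collect_eq continuous_intros continuous_on_product_coordinates)
      then show "\<psi> (f + g) = \<psi> f + \<psi> g"
        using cl[of "{\<phi>. \<phi> (f + g) = \<phi> f + \<phi> g}" 0] by simp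
      have "closed {\<phi> :: ('x \<Rightarrow>\<^sub>C real) \<Rightarrow> real. \<phi> (r *\<^sub>R f) = r *\<^sub>R \<phi> f}"
        by (intro closed_Collect_eq continuous_intros continuous_on_product_coordinates)
      then show "\<psi> (r *\<^sub>R f) = r *\<^sub>R \<psi> f"
        using cl[of "{\<phi>. \<phi> (r *\<^sub>R f) = r *\<^sub>R \<phi> f}" 0] by simp
      show "norm (\<psi> f) \<le> norm f * 1"
        using \<psi> by (auto simp: S_def PiE_def)
    qed
  next
    fix C :: "real set" and f n
    assume "closed C" "\<And>m. m \<ge> n \<Longrightarrow> apply_bcontfun f (x m) \<in> C"
    moreover have "closed ((\<lambda>\<phi> :: ('x \<Rightarrow>\<^sub>C real) \<Rightarrow> real. \<phi> f) -` C)"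
      using \<open>closed C\<close> by (intro closed_vimage continuous_on_product_coordinates)
    ultimately show "\<psi> f \<in> C"
      using cl[of "(\<lambda>\<phi>. \<phi> f) -` C" n] by simp
  qed
qed

text \<open>A double limit argument in the style of Grothendieck. By \<open>near\<close>, the
  components of a weak cluster pair \<open>p\<close> of \<open>(a n, b n)\<close> agree at every
  \<open>x m\<close>, so a cluster functional \<open>\<psi>\<close> of the evaluations vanishes on
  their difference. By \<open>far\<close>, \<open>\<psi>\<close> stays at least \<epsilon> in
  absolute value on every \<open>a n - b n\<close>, and weak continuity transfers this to
  \<open>p\<close>.\<close>

lemma relatively_weakly_compact_double_limit:
  fixes a b :: "nat \<Rightarrow> 'x::topological_space \<Rightarrow>\<^sub>C real"
  assumes A: "relatively_weakly_compact A"
    and ab: "\<And>n. a n \<in> A" "\<And>n. b n \<in> A"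
    and near: "\<And>m n. m < n \<Longrightarrow> \<bar>a n (x m) - b n (x m)\<bar> < 1 / real n"
    and far: "\<And>m n. n \<le> m \<Longrightarrow> \<bar>a n (x m) - b n (x m)\<bar> \<ge> \<epsilon>"
  shows "\<epsilon> \<le> 0"
proof -
  let ?W = "weak_topology :: ('x \<Rightarrow>\<^sub>C real) topology" and ?K = "weak_topology closure_of A"
  have "A \<subseteq> ?K" by (simp add: closure_of_subset)
  then have "(a n, b n) \<in> ?K \<times> ?K" for n using ab by blast
  \<comment> \<open>Clustering in the product keeps \<open>a\<close> and \<open>b\<close> on the
    same indices, so that their differences can be followed.\<close>
  moreover have "compactin (prod_topology ?W ?W) (?K \<times> ?K)"
    using A by (simp add: relatively_weakly_compact_def compactin_Times)
  ultimately obtain p where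
    p: "\<And>C n. closedin (prod_topology ?W ?W) C \<Longrightarrow> (\<And>i. i \<ge> n \<Longrightarrow> (a i, b i) \<in> C) \<Longrightarrow> p \<in> C"
    using compactin_cluster_point[where s = "\<lambda>n. (a n, b n)"] by metis
  have lim: "\<bar>\<phi> (fst p) - \<phi> (snd p)\<bar> \<in> C"
    if "bounded_linear \<phi>" "closed C" "\<And>i. i \<ge> n \<Longrightarrow> \<bar>\<phi> (a i) - \<phi> (b i)\<bar> \<in> C"
    for \<phi> :: "('x \<Rightarrow>\<^sub>C real) \<Rightarrow> real" and C n
  proof -
    have "continuous_map (prod_topology ?W ?W) euclideanreal (\<lambda>q. \<bar>\<phi> (fst q) - \<phi> (snd q)\<bar>)"
      using continuous_map_weak_topology[OF that(1)]
      by (intro continuous_map_real_abs continuous_map_diff continuous_map_compose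
          [of _ _ fst _ \<phi>, unfolded o_def] continuous_map_compose[of _ _ snd _ \<phi>, unfolded o_def])
         (auto intro: continuous_map_fst continuous_map_snd)
    then have "closedin (prod_topology ?W ?W) {q. \<bar>\<phi> (fst q) - \<phi> (snd q)\<bar> \<in> C}"
      using \<open>closed C\<close> by (force dest: closedin_continuous_map_preimage[where C = C])
    from p[OF this, of n] show ?thesis using that(3) by simp
  qed
  have eq: "fst p (x m) = snd p (x m)" for m
  proof -
    have "\<bar>fst p (x m) - snd p (x m)\<bar> \<le> e" if "e > 0" for e
    proof -
      obtain n where n: "1 / real n < e" "n > 0"
        using \<open>e > 0\<close> by (metis ex_inverse_of_nat_less inverse_eq_divide)
      \<comment> \<open>Past \<open>n\<close> the bound \<open>1 / i\<close> is below
        \<open>e\<close>; past \<open>m\<close> the hypothesis \<open>near\<close> applies.\<close>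
      have "\<bar>a i (x m) - b i (x m)\<bar> \<in> {..e}" if "i \<ge> max n (Suc m)" for i
      proof -
        have "1 / real i \<le> 1 / real n" using that n by (simp add: frac_le)
        with near[of m i] n that show ?thesis by simp
      qed
      then show ?thesis
        using lim[OF bounded_linear_apply_bcontfun[of "x m"], of "{..e}" "max n (Suc m)"] by simp
    qed
    from field_le_epsilon[of "\<bar>fst p (x m) - snd p (x m)\<bar>" 0] this show ?thesis by simp
  qed
  obtain \<psi> :: "('x \<Rightarrow>\<^sub>C real) \<Rightarrow> real" where \<psi>: "bounded_linear \<psi>"
    "\<And>C f n. closed C \<Longrightarrow> (\<And>m. m \<ge> n \<Longrightarrow> apply_bcontfun f (x m) \<in> C) \<Longrightarrow> \<psi> f \<in> C"
    using cluster_functional by metis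
  interpret \<psi>: bounded_linear \<psi> by fact
  \<comment> \<open>The sign of \<open>a n - b n\<close> at \<open>x m\<close> may vary with
    \<open>m\<close>, so the closed set bounds the absolute value; it contains these values from
    \<open>m = n\<close> on.\<close>
  have "closed {r::real. \<epsilon> \<le> \<bar>r\<bar>}"
    by (intro closed_Collect_le continuous_intros)
  then have "\<psi> (a n - b n) \<in> {r. \<epsilon> \<le> \<bar>r\<bar>}" for n
    by (rule \<psi>(2)[where n = n]) (use far in simp)
  then have "\<epsilon> \<le> \<bar>\<psi> (fst p) - \<psi> (snd p)\<bar>"
    using lim[OF \<psi>(1), of "{\<epsilon>..}" 0] by (simp add: \<psi>.diff)
  moreover have "\<psi> (fst p - snd p) \<in> {0}"
    by (rule \<psi>(2)[where n = 0]) (simp_all add: eq)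
  ultimately show ?thesis by (simp add: \<psi>.diff)
qed

text \<open>If all \<open>F\<close>, \<delta>, \<open>U\<close> had counterexamples, a recursion
  would build the configuration excluded by the double limit lemma: each new pair is nearly equal at
  all earlier points, while later points stay in the open set where the pair is far apart.\<close>

lemma relatively_weakly_compact_uniform_on_piece:
  fixes A :: "('x::topological_space \<Rightarrow>\<^sub>C real) set"
  assumes A: "relatively_weakly_compact A" and D: "D \<noteq> {}" and \<epsilon>: "\<epsilon> > 0"
  obtains F \<delta> U where "finite F" "\<delta> > 0" "open U" "U \<inter> D \<noteq> {}"
    "\<And>a b x. a \<in> A \<Longrightarrow> b \<in> A \<Longrightarrow> (\<And>y. y \<in> F \<Longrightarrow> \<bar>a y - b y\<bar> < \<delta>) \<Longrightarrow> x \<in> U \<inter> D \<Longrightarrow> \<bar>a x - b x\<bar> \<le> \<epsilon>"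
proof (rule ccontr)
  assume "\<not> thesis"
  with that have H: "\<exists>a\<in>A. \<exists>b\<in>A. \<exists>x\<in>U \<inter> D. (\<forall>y\<in>F. \<bar>a y - b y\<bar> < \<delta>) \<and> \<bar>a x - b x\<bar> > \<epsilon>"
    if "finite F" "\<delta> > 0" "open U" "U \<inter> D \<noteq> {}" for F \<delta> U
    using that by (meson not_le)
  \<comment> \<open>A stage: \<open>F\<close> collects the points chosen so far, including the new
    \<open>x\<close>; the pair stays apart on all of \<open>U\<close>. The point \<open>x\<close>
    witnesses that \<open>U\<close> meets \<open>D\<close>, so the recursion can continue.\<close>
  define P where "P = (\<lambda>(F, U, a, b, x). finite F \<and> open U \<and> x \<in> F \<and> x \<in> U \<inter> D \<and> a \<in> A \<and> b \<in> A \<and>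
      (\<forall>y\<in>U. \<bar>apply_bcontfun a y - apply_bcontfun b y\<bar> > \<epsilon>))"
  \<comment> \<open>The pair of stage \<open>Suc n\<close> is tested on the points collected up to
    stage \<open>n\<close>, so the tolerance \<open>1 / Suc n\<close> becomes \<open>1 / n\<close>
    in \<open>near\<close> after the index shift.\<close>
  define Q where "Q = (\<lambda>n::nat. \<lambda>(F :: 'x set, U :: 'x set, _ :: 'x \<Rightarrow>\<^sub>C real, _ :: 'x \<Rightarrow>\<^sub>C real, _ :: 'x) (F', U', a', b', _ :: 'x).
      F \<subseteq> F' \<and> U' \<subseteq> U \<and> (\<forall>y\<in>F. \<bar>apply_bcontfun a' y - apply_bcontfun b' y\<bar> < 1 / real (Suc n)))"
  have step: "\<exists>a b x. P (insert x F, U \<inter> {y. \<bar>apply_bcontfun a y - apply_bcontfun b y\<bar> > \<epsilon>}, a, b, x) \<and>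
      (\<forall>y\<in>F. \<bar>a y - b y\<bar> < \<delta>)"
    if FU: "finite F" "\<delta> > 0" "open U" "U \<inter> D \<noteq> {}" for F \<delta> U
  proof -
    from H[OF FU] obtain a b x where abx: "a \<in> A" "b \<in> A" "x \<in> U \<inter> D"
      "\<forall>y\<in>F. \<bar>a y - b y\<bar> < \<delta>" "\<bar>a x - b x\<bar> > \<epsilon>"
      by blast
    have "open {y. \<bar>a y - b y\<bar> > \<epsilon>}"
      by (intro open_Collect_less continuous_intros continuous_on_apply_bcontfun)
    with abx FU show ?thesis
      by (intro exI[of _ a] exI[of _ b] exI[of _ x]) (auto simp: P_def)
  qed
  have "\<exists>s. P s"
    using step[of "{}" 1 UNIV] D by auto
  moreover have "\<exists>t. P t \<and> Q n s t" if "P s" for s n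
  proof -
    obtain F U a b x where s: "s = (F, U, a, b, x)" by (cases s) auto
    with that have "finite F" "open U" "U \<inter> D \<noteq> {}" by (auto simp: P_def)
    from step[OF this(1) _ this(2,3), of "1 / real (Suc n)"]
    show ?thesis by (force simp: s Q_def)
  qed
  ultimately obtain s where s: "\<And>n. P (s n)" "\<And>n. Q n (s n) (s (Suc n))"
    using dependent_nat_choice[of "\<lambda>_. P" Q] by blast
  define F where "F n = fst (s n)" for n
  define U where "U n = fst (snd (s n))" for n
  define a where "a n = fst (snd (snd (s n)))" for n
  define b where "b n = fst (snd (snd (snd (s n))))" for n
  define x where "x n = snd (snd (snd (snd (s n))))" for n
  have sn: "s n = (F n, U n, a n, b n, x n)" for n
    by (simp add: F_def U_def a_def b_def x_def)
  have P: "x n \<in> F n" "x n \<in> U n" "a n \<in> A" "b n \<in> A"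
      "y \<in> U n \<Longrightarrow> \<bar>a n y - b n y\<bar> > \<epsilon>" for n y
    using s(1)[of n] by (auto simp: P_def sn)
  have Q: "F n \<subseteq> F (Suc n)" "U (Suc n) \<subseteq> U n"
      "y \<in> F n \<Longrightarrow> \<bar>a (Suc n) y - b (Suc n) y\<bar> < 1 / real (Suc n)" for n y
    using s(2)[of n] by (auto simp: Q_def sn)
  have F: "F m \<subseteq> F n" if "m \<le> n" for m n
    using lift_Suc_mono_le[of F, OF Q(1) that] .
  have U: "U n \<subseteq> U m" if "m \<le> n" for m n
    using lift_Suc_antimono_le[of U, OF Q(2) that] .
  have near: "\<bar>a n (x m) - b n (x m)\<bar> < 1 / real n" if mn: "m < n" for m n
  proof -
    obtain k where k: "n = Suc k" "m \<le> k" using mn by (cases n) auto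
    then show ?thesis using Q(3)[of "x m" k] F[of m k] P(1)[of m] by auto
  qed
  have far: "\<bar>a n (x m) - b n (x m)\<bar> \<ge> \<epsilon>" if "n \<le> m" for m n
    using P(5)[of "x m" n] U[OF that] P(2)[of m] by (simp add: less_imp_le subset_iff)
  have "\<epsilon> \<le> 0"
    by (rule relatively_weakly_compact_double_limit[OF A P(3,4) near far])
  with \<epsilon> show False by simp
qed

text \<open>Closeness on \<open>F\<close> involves finitely many evaluations, which are weakly
  continuous. The weakly open sets \<open>V b\<close> centred in \<open>A\<close> cover the weak
  closure, and compactness leaves finitely many.\<close>

lemma relatively_weakly_compact_finite_net:
  fixes A :: "('x::topological_space \<Rightarrow>\<^sub>C real) set"
  assumes A: "relatively_weakly_compact A" and F: "finite F" and \<delta>: "\<delta> > 0"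
  obtains N where "finite N" "N \<subseteq> A" "\<And>a. a \<in> A \<Longrightarrow> \<exists>b\<in>N. \<forall>y\<in>F. \<bar>a y - b y\<bar> < \<delta>"
proof -
  let ?W = "weak_topology :: ('x \<Rightarrow>\<^sub>C real) topology"
  define V where "V b = {a :: 'x \<Rightarrow>\<^sub>C real. \<forall>y\<in>F. \<bar>a y - b y\<bar> < \<delta>}" for b :: "'x \<Rightarrow>\<^sub>C real"
  have V: "openin ?W (V b)" for b
  proof -
    have "openin ?W {a. \<bar>apply_bcontfun a y - b y\<bar> < \<delta>}" for y
    proof -
      have "openin ?W {a \<in> topspace ?W. apply_bcontfun a y \<in> ball (b y) \<delta>}"
        by (rule openin_continuous_map_preimage
            [OF continuous_map_weak_topology[OF bounded_linear_apply_bcontfun]]) simp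
      then show ?thesis by (simp add: dist_real_def abs_minus_commute)
    qed
    \<comment> \<open>The factor \<open>topspace ?W\<close> also covers the case of empty
      \<open>F\<close>.\<close>
    then have "openin ?W (topspace ?W \<inter> (\<Inter>y\<in>F. {a. \<bar>apply_bcontfun a y - b y\<bar> < \<delta>}))"
      using F openin_topspace[of ?W] by (intro openin_Int_Inter) auto
    moreover have "topspace ?W \<inter> (\<Inter>y\<in>F. {a. \<bar>apply_bcontfun a y - b y\<bar> < \<delta>}) = V b"
      by (auto simp: V_def)
    ultimately show ?thesis by simp
  qed
  have "?W closure_of A \<subseteq> \<Union>(V ` A)"
  proof
    fix a assume a: "a \<in> ?W closure_of A"
    \<comment> \<open>As a weak neighbourhood of \<open>a\<close>, \<open>V a\<close> meets
      \<open>A\<close> in some \<open>b\<close>; closeness on \<open>F\<close> is symmetric, so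
      \<open>a\<close> lies in \<open>V b\<close>.\<close>
    have "a \<in> V a" using \<delta> by (simp add: V_def)
    with V a obtain b where "b \<in> A" "b \<in> V a" by (auto simp: in_closure_of)
    then have "a \<in> V b" by (simp add: V_def abs_minus_commute)
    with \<open>b \<in> A\<close> show "a \<in> \<Union>(V ` A)" by blast
  qed
  with V A obtain \<N> where "finite \<N>" "\<N> \<subseteq> V ` A" and cov: "?W closure_of A \<subseteq> \<Union>\<N>"
    unfolding relatively_weakly_compact_def by (metis (no_types, lifting) compactinD imageE)
  then obtain N where N: "finite N" "N \<subseteq> A" "\<N> = V ` N"
    by (meson finite_subset_image)
  show thesis
  proof (rule that[OF N(1,2)])
    fix a assume "a \<in> A"
    then have "a \<in> ?W closure_of A" using closure_of_subset[of A ?W] by auto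
    with cov N(3) show "\<exists>b\<in>N. \<forall>y\<in>F. \<bar>a y - b y\<bar> < \<delta>" by (auto simp: V_def)
  qed
qed

text \<open>On a suitable piece every member of \<open>A\<close> is uniformly close to one of
  finitely many continuous functions; shrinking the piece around a point \<open>p\<close> makes
  these oscillate little.\<close>

proposition relatively_weakly_compact_small_oscillation:
  fixes A :: "('x::topological_space \<Rightarrow>\<^sub>C real) set"
  assumes A: "relatively_weakly_compact A" and D: "D \<noteq> {}" and \<epsilon>: "\<epsilon> > 0"
  obtains U where "open U" "U \<inter> D \<noteq> {}"
    "\<And>a x y. a \<in> A \<Longrightarrow> x \<in> U \<inter> D \<Longrightarrow> y \<in> U \<inter> D \<Longrightarrow> \<bar>a x - a y\<bar> \<le> \<epsilon>"
proof -
  \<comment> \<open>Three errors of \<epsilon>/6 bound \<open>a u - a p\<close> by \<epsilon>/2, and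
    passing from \<open>x\<close> to \<open>y\<close> through \<open>p\<close> doubles this.\<close>
  have "\<epsilon> / 6 > 0" using \<epsilon> by simp
  from relatively_weakly_compact_uniform_on_piece[OF A D this]
  obtain F \<delta> U where FU: "finite F" "\<delta> > 0" "open U" "U \<inter> D \<noteq> {}"
    and near: "\<And>a b x. a \<in> A \<Longrightarrow> b \<in> A \<Longrightarrow> (\<And>y. y \<in> F \<Longrightarrow> \<bar>a y - b y\<bar> < \<delta>) \<Longrightarrow> x \<in> U \<inter> D
      \<Longrightarrow> \<bar>a x - b x\<bar> \<le> \<epsilon> / 6"
    by metis
  obtain N where N: "finite N" "N \<subseteq> A" "\<And>a. a \<in> A \<Longrightarrow> \<exists>b\<in>N. \<forall>y\<in>F. \<bar>a y - b y\<bar> < \<delta>"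
    using relatively_weakly_compact_finite_net[OF A FU(1,2)] by metis
  obtain p where p: "p \<in> U \<inter> D" using FU(4) by blast
  define V where "V = U \<inter> (\<Inter>b\<in>N. {y. \<bar>apply_bcontfun b y - b p\<bar> < \<epsilon> / 6})"
  show thesis
  proof
    show "open V"
      unfolding V_def using N(1) FU(3)
      by (intro open_Int open_INT ballI open_Collect_less continuous_intros
          continuous_on_apply_bcontfun)
    show "V \<inter> D \<noteq> {}" using p \<epsilon> by (auto simp: V_def)
    fix a x y assume a: "a \<in> A" and xy: "x \<in> V \<inter> D" "y \<in> V \<inter> D"
    obtain b where b: "b \<in> N" "\<forall>y\<in>F. \<bar>a y - b y\<bar> < \<delta>" using N(3)[OF a] by blast
    have "\<bar>a u - a p\<bar> \<le> \<epsilon> / 2" if "u \<in> V \<inter> D" for u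
    proof -
      have "\<bar>b u - b p\<bar> < \<epsilon> / 6" "u \<in> U \<inter> D" using that b(1) by (auto simp: V_def)
      moreover have "\<bar>a u - b u\<bar> \<le> \<epsilon> / 6" "\<bar>a p - b p\<bar> \<le> \<epsilon> / 6"
        using near[of a b] a b N(2) p \<open>u \<in> U \<inter> D\<close> by blast+
      ultimately show ?thesis by linarith
    qed
    from this[OF xy(1)] this[OF xy(2)] show "\<bar>a x - a y\<bar> \<le> \<epsilon>" by linarith
  qed
qed

section \<open>Equicontinuity on orbit closures\<close>

context flow
begin

lemma act_inv_cancel:
  assumes "h \<in> carrier G"
  shows "act (inv h) (act h x) = x"
  using orbit_sym_aux[OF assms] by simp

lemma act_closure_orbit:
  assumes "g \<in> carrier G" "x \<in> closure (orbit G act z)"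
  shows "act g x \<in> closure (orbit G act z)"
proof -
  have "act g ` orbit G act z \<subseteq> orbit G act z"
    using assms(1) by (force simp: orbit_def composition_rule[symmetric])
  then have "act g ` closure (orbit G act z) \<subseteq> closure (orbit G act z)"
    using continuous_on_subset[OF continuous_act_space[OF assms(1)]] closure_subset
    by (intro image_closure_subset) auto
  with assms(2) show ?thesis by blast
qed

text \<open>The oscillation result is applied to \<open>fG\<close> on the orbit. The piece meets the
  orbit at some \<open>act h z\<close>, possibly not at \<open>z\<close> itself.\<close>

lemma WAP_orbit_small_oscillation:
  assumes f: "f \<in> WAP G act" and \<epsilon>: "\<epsilon> > 0"
  obtains U h where "open U" "h \<in> carrier G" "act h z \<in> U"
    "\<And>g x y. g \<in> carrier G \<Longrightarrow> x \<in> U \<inter> closure (orbit G act z) \<Longrightarrow>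
      y \<in> U \<inter> closure (orbit G act z) \<Longrightarrow> \<bar>f (act g x) - f (act g y)\<bar> \<le> \<epsilon>"
proof -
  let ?D = "orbit G act z"
  have "relatively_weakly_compact (translate act f ` carrier G)" "?D \<noteq> {}"
    using f orbit_refl[of z] by (auto simp: WAP_def)
  from relatively_weakly_compact_small_oscillation[OF this \<epsilon>]
  obtain U where U: "open U" "U \<inter> ?D \<noteq> {}"
    and osc: "\<And>a x y. a \<in> translate act f ` carrier G \<Longrightarrow> x \<in> U \<inter> ?D \<Longrightarrow> y \<in> U \<inter> ?D
      \<Longrightarrow> \<bar>a x - a y\<bar> \<le> \<epsilon>"
    by metis
  obtain h where h: "h \<in> carrier G" "act h z \<in> U"
    using U(2) by (auto simp: orbit_def)
  show thesis
  proof (rule that[OF U(1) h])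
    fix g x y
    assume g: "g \<in> carrier G" and xy: "x \<in> U \<inter> closure ?D" "y \<in> U \<inter> closure ?D"
    \<comment> \<open>For fixed \<open>g\<close> this is a closed condition on pairs, so it passes
      to the closure of \<open>U \<inter> ?D\<close>, which contains
      \<open>U \<inter> closure ?D\<close> because \<open>U\<close> is open.\<close>
    let ?C = "{p. \<bar>translate act f g (fst p) - translate act f g (snd p)\<bar> \<le> \<epsilon>}"
    have "closed ?C"
      by (intro closed_Collect_le continuous_intros
          continuous_on_compose2[OF continuous_on_apply_bcontfun[of UNIV]]) auto
    moreover have "(U \<inter> ?D) \<times> (U \<inter> ?D) \<subseteq> ?C"
      using osc g by auto
    ultimately have "closure (U \<inter> ?D) \<times> closure (U \<inter> ?D) \<subseteq> ?C"
      unfolding closure_Times[symmetric] by (intro closure_minimal)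
    moreover have "U \<inter> closure ?D \<subseteq> closure (U \<inter> ?D)"
      by (rule open_Int_closure_subset[OF U(1)])
    ultimately have "(x, y) \<in> ?C" using xy by blast
    then show "\<bar>f (act g x) - f (act g y)\<bar> \<le> \<epsilon>"
      by (simp add: apply_translate[OF g])
  qed
qed

text \<open>The piece around \<open>act h z\<close> is pulled back to \<open>z\<close> by
  \<open>h\<close>: acting by \<open>g\<close> is acting by \<open>h\<close> and then by
  \<open>g \<otimes> inv h\<close>, and the oscillation bound is uniform over the group.\<close>

lemma WAP_equicontinuous_on_orbit_closure:
  assumes f: "f \<in> WAP G act" and \<epsilon>: "\<epsilon> > 0"
  obtains V where "open V" "z \<in> V"
    "\<And>g x. g \<in> carrier G \<Longrightarrow> x \<in> V \<inter> closure (orbit G act z) \<Longrightarrow> \<bar>f (act g x) - f (act g z)\<bar> < \<epsilon>"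
proof -
  have "\<epsilon> / 2 > 0" using \<epsilon> by simp
  from WAP_orbit_small_oscillation[OF f this, of z]
  obtain U h where U: "open U" "h \<in> carrier G" "act h z \<in> U"
    and osc: "\<And>g x y. g \<in> carrier G \<Longrightarrow> x \<in> U \<inter> closure (orbit G act z) \<Longrightarrow>
      y \<in> U \<inter> closure (orbit G act z) \<Longrightarrow> \<bar>f (act g x) - f (act g y)\<bar> \<le> \<epsilon> / 2"
    by metis
  show thesis
  proof (rule that[of "act h -` U"])
    show "open (act h -` U)"
      by (rule open_vimage[OF U(1) continuous_act_space[OF U(2)]])
    show "z \<in> act h -` U" using U by simp
    fix g x assume g: "g \<in> carrier G" and x: "x \<in> act h -` U \<inter> closure (orbit G act z)"
    have z: "z \<in> closure (orbit G act z)"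
      using orbit_refl[of z] closure_subset by auto
    have "g \<otimes> inv h \<in> carrier G" using g U(2) by simp
    then have "\<bar>f (act (g \<otimes> inv h) (act h x)) - f (act (g \<otimes> inv h) (act h z))\<bar> \<le> \<epsilon> / 2"
      by (rule osc) (use x z U act_closure_orbit in auto)
    moreover have "act (g \<otimes> inv h) (act h w) = act g w" for w
      using g U(2) by (simp add: composition_rule act_inv_cancel)
    ultimately show "\<bar>f (act g x) - f (act g z)\<bar> < \<epsilon>" using \<epsilon> by simp
  qed
qed

lemma WAP_finite_equicontinuous_on_orbit_closure:
  assumes J: "finite J" "J \<subseteq> WAP G act" and \<epsilon>: "\<epsilon> > 0"
  obtains V where "open V" "z \<in> V"
    "\<And>f g x. f \<in> J \<Longrightarrow> g \<in> carrier G \<Longrightarrow> x \<in> V \<inter> closure (orbit G act z)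
      \<Longrightarrow> \<bar>f (act g x) - f (act g z)\<bar> < \<epsilon>"
proof -
  have "\<forall>f\<in>J. \<exists>V. open V \<and> z \<in> V \<and> (\<forall>g\<in>carrier G. \<forall>x\<in>V \<inter> closure (orbit G act z).
      \<bar>f (act g x) - f (act g z)\<bar> < \<epsilon>)"
    using WAP_equicontinuous_on_orbit_closure[OF _ \<epsilon>, of _ z] J(2) by (metis subset_iff)
  then obtain V :: "('x \<Rightarrow>\<^sub>C real) \<Rightarrow> 'x set" where V: "\<forall>f\<in>J. open (V f) \<and> z \<in> V f \<and>
      (\<forall>g\<in>carrier G. \<forall>x\<in>V f \<inter> closure (orbit G act z). \<bar>f (act g x) - f (act g z)\<bar> < \<epsilon>)"
    by metis
  show thesis
    by (rule that[of "\<Inter>f\<in>J. V f"]) (use V J(1) in \<open>auto intro: open_INT\<close>)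
qed

end

section \<open>The uniformity generated by a family of functions\<close>

text \<open>The initial uniformity on \<open>Y\<close> induced by the functions in \<open>A\<close>.
  The parameter \<open>Y\<close> lets one construction serve both the whole space and a
  subflow.\<close>

definition function_uniformity :: "('x::topological_space \<Rightarrow>\<^sub>C real) set \<Rightarrow> 'x set \<Rightarrow> ('x \<times> 'x) filter" where
  "function_uniformity A Y = (INF (J, \<epsilon>) \<in> {J. finite J \<and> J \<subseteq> A} \<times> {0<..}.
     principal {(x, y). x \<in> Y \<and> y \<in> Y \<and>
       (\<forall>f\<in>J. \<bar>apply_bcontfun f x - apply_bcontfun f y\<bar> < \<epsilon>)})"

lemma eventually_function_uniformity:
  "eventually E (function_uniformity A Y) \<longleftrightarrow>
     (\<exists>J \<epsilon>. finite J \<and> J \<subseteq> A \<and> \<epsilon> > 0 \<and>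
       (\<forall>x\<in>Y. \<forall>y\<in>Y. (\<forall>f\<in>J. \<bar>f x - f y\<bar> < \<epsilon>) \<longrightarrow> E (x, y)))"
  (is "_ \<longleftrightarrow> ?rhs")
proof -
  let ?B = "{J. finite J \<and> J \<subseteq> A} \<times> {0::real<..}"
  let ?F = "\<lambda>(J, \<epsilon>). principal {(x, y). x \<in> Y \<and> y \<in> Y \<and> (\<forall>f\<in>J. \<bar>apply_bcontfun f x - f y\<bar> < \<epsilon>)}"
  have "eventually E (function_uniformity A Y) \<longleftrightarrow> (\<exists>p\<in>?B. eventually E (?F p))"
    unfolding function_uniformity_def
  proof (rule eventually_INF_base)
    have "({}, 1) \<in> ?B" by simp
    then show "?B \<noteq> {}" by blast
    fix p q assume p: "p \<in> ?B" and q: "q \<in> ?B"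
    show "\<exists>r\<in>?B. ?F r \<le> inf (?F p) (?F q)"
      \<comment> \<open>The basic entourages are directed: unite the finite sets and take the
        smaller tolerance.\<close>
      by (rule bexI[of _ "(fst p \<union> fst q, min (snd p) (snd q))"])
         (use p q in \<open>auto simp: case_prod_unfold\<close>)
  qed
  also have "\<dots> \<longleftrightarrow> (\<exists>J \<epsilon>. finite J \<and> J \<subseteq> A \<and> \<epsilon> > 0 \<and> eventually E (?F (J, \<epsilon>)))"
    unfolding Bex_def split_paired_Ex by simp
  also have "\<dots> \<longleftrightarrow> ?rhs"
    by (intro ex_cong1 conj_cong refl) (auto simp: eventually_principal)
  finally show ?thesis .
qed

lemma uniformity_of_function_uniformity: "uniformity_of Y (function_uniformity A Y)"
proof -
  have "\<forall>x\<in>Y. E (x, x)"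
    "eventually (\<lambda>(x, y). E (y, x)) (function_uniformity A Y)"
    "\<exists>D. eventually D (function_uniformity A Y) \<and> (\<forall>x y z. D (x, y) \<longrightarrow> D (y, z) \<longrightarrow> E (x, z))"
    if "eventually E (function_uniformity A Y)" for E
  proof -
    from that obtain J \<epsilon> where J: "finite J" "J \<subseteq> A" "\<epsilon> > 0"
      and E: "\<And>x y. x \<in> Y \<Longrightarrow> y \<in> Y \<Longrightarrow> (\<forall>f\<in>J. \<bar>f x - f y\<bar> < \<epsilon>) \<Longrightarrow> E (x, y)"
      unfolding eventually_function_uniformity by blast
    show "\<forall>x\<in>Y. E (x, x)" using E J(3) by simp
    show "eventually (\<lambda>(x, y). E (y, x)) (function_uniformity A Y)"
      unfolding eventually_function_uniformity
      by (rule exI[of _ J], rule exI[of _ \<epsilon>]) (use J E in \<open>simp add: abs_minus_commute\<close>)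
    \<comment> \<open>Membership in \<open>Y\<close> is built in since \<open>E\<close> is
      controlled only there, while the composition law quantifies over the whole type.\<close>
    let ?D = "\<lambda>(x, y). x \<in> Y \<and> y \<in> Y \<and> (\<forall>f\<in>J. \<bar>f x - f y\<bar> < \<epsilon> / 2)"
    have "eventually ?D (function_uniformity A Y)"
      unfolding eventually_function_uniformity
      by (rule exI[of _ J], rule exI[of _ "\<epsilon> / 2"]) (use J in simp)
    moreover have "E (x, z)" if "?D (x, y)" "?D (y, z)" for x y z
    proof (rule E)
      show "\<forall>f\<in>J. \<bar>f x - f z\<bar> < \<epsilon>"
      proof
        fix f assume "f \<in> J"
        then have "\<bar>f x - f y\<bar> < \<epsilon> / 2" "\<bar>f y - f z\<bar> < \<epsilon> / 2" using that by auto
        then show "\<bar>f x - f z\<bar> < \<epsilon>" by linarith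
      qed
    qed (use that in auto)
    ultimately show "\<exists>D. eventually D (function_uniformity A Y) \<and>
        (\<forall>x y z. D (x, y) \<longrightarrow> D (y, z) \<longrightarrow> E (x, z))"
      by blast
  qed
  moreover have "function_uniformity A Y \<le> principal (Y \<times> Y)"
    unfolding le_principal eventually_function_uniformity
    by (rule exI[of _ "{}"], rule exI[of _ 1]) simp
  ultimately show ?thesis
    unfolding uniformity_of_def by blast
qed

lemma compatible_function_uniformity:
  fixes A :: "('x::topological_space \<Rightarrow>\<^sub>C real) set"
  assumes "separates_points_and_closed_sets A"
  shows "compatible_uniformity (top_of_set Y) (function_uniformity A Y)"
proof -
  let ?\<mu> = "function_uniformity A Y"
  have "openin (top_of_set Y) U \<longleftrightarrow>
      U \<subseteq> Y \<and> (\<forall>x\<in>U. eventually (\<lambda>(x', y). x' = x \<longrightarrow> y \<in> U) ?\<mu>)" for U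
  proof
    assume "openin (top_of_set Y) U"
    then obtain W where W: "open W" "U = Y \<inter> W" by (auto simp: openin_open)
    have "eventually (\<lambda>(x', y). x' = x \<longrightarrow> y \<in> U) ?\<mu>" if "x \<in> U" for x
    proof -
      have "closed (- W)" "x \<notin> - W" using W that by auto
      then obtain f where f: "f \<in> A" "f x \<notin> closure (apply_bcontfun f ` (- W))"
        using assms unfolding separates_points_and_closed_sets_def by blast
      \<comment> \<open>The value \<open>f x\<close> has positive distance from the image of
        \<open>- W\<close>, so a single function gives the entourage that keeps points of
        \<open>Y\<close> close to \<open>x\<close> inside \<open>W\<close>.\<close>
      then obtain \<epsilon> where \<epsilon>: "\<epsilon> > 0" "\<And>y. y \<in> - W \<Longrightarrow> \<not> dist (f y) (f x) < \<epsilon>"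
        by (auto simp: closure_approachable)
      show ?thesis
        unfolding eventually_function_uniformity
        by (rule exI[of _ "{f}"], rule exI[of _ \<epsilon>])
           (use f \<epsilon> W in \<open>auto simp: dist_real_def abs_minus_commute\<close>)
    qed
    with W show "U \<subseteq> Y \<and> (\<forall>x\<in>U. eventually (\<lambda>(x', y). x' = x \<longrightarrow> y \<in> U) ?\<mu>)" by blast
  next
    assume U: "U \<subseteq> Y \<and> (\<forall>x\<in>U. eventually (\<lambda>(x', y). x' = x \<longrightarrow> y \<in> U) ?\<mu>)"
    have "\<exists>T. openin (top_of_set Y) T \<and> x \<in> T \<and> T \<subseteq> U" if x: "x \<in> U" for x
    proof -
      from U x have "x \<in> Y" and "eventually (\<lambda>(x', y). x' = x \<longrightarrow> y \<in> U) ?\<mu>" by auto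
      then obtain J \<epsilon> where J: "finite J" "J \<subseteq> A" "\<epsilon> > 0" and
        "\<forall>x'\<in>Y. \<forall>y\<in>Y. (\<forall>f\<in>J. \<bar>f x' - f y\<bar> < \<epsilon>) \<longrightarrow>
          (case (x', y) of (x', y) \<Rightarrow> x' = x \<longrightarrow> y \<in> U)"
        unfolding eventually_function_uniformity by blast
      then have E: "y \<in> U" if "y \<in> Y" "\<forall>f\<in>J. \<bar>apply_bcontfun f x - f y\<bar> < \<epsilon>" for y
        using \<open>x \<in> Y\<close> that by simp
      have "open (\<Inter>f\<in>J. {y. \<bar>apply_bcontfun f x - apply_bcontfun f y\<bar> < \<epsilon>})"
        using J(1) by (intro open_INT ballI open_Collect_less continuous_intros
            continuous_on_apply_bcontfun)
      then have "openin (top_of_set Y) (Y \<inter> (\<Inter>f\<in>J. {y. \<bar>apply_bcontfun f x - apply_bcontfun f y\<bar> < \<epsilon>}))"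
        by (rule openin_open_Int)
      then show ?thesis
        by (rule_tac x = "Y \<inter> (\<Inter>f\<in>J. {y. \<bar>apply_bcontfun f x - apply_bcontfun f y\<bar> < \<epsilon>})" in exI)
           (use E J U x in auto)
    qed
    then show "openin (top_of_set Y) U"
      using openin_subopen[of "top_of_set Y" U] by blast
  qed
  then show ?thesis
    unfolding compatible_uniformity_def by (simp add: uniformity_of_function_uniformity)
qed

section \<open>Local equicontinuity and equicontinuity of quasiminimal subflows\<close>

context flow
begin

text \<open>Common core of both claims. Local equicontinuity takes \<open>Z\<close> the orbit
  closure and \<open>Y\<close>, \<open>W\<close> the whole space; the quasiminimal case takes
  \<open>Z = Y\<close> and \<open>W\<close> a neighbourhood of \<open>z\<close> whose trace on
  \<open>Y\<close> lies in the orbit closure.\<close>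

lemma WAP_uniformity_equicontinuity_point:
  assumes Z: "Z \<subseteq> Y" "invariant_subset G act Y"
    and sub: "open W" "z \<in> W" "W \<inter> Z \<subseteq> closure (orbit G act z)" and z: "z \<in> Z"
    and E: "eventually E (function_uniformity (WAP G act) Y)"
  shows "\<exists>U. openin (top_of_set Z) U \<and> z \<in> U \<and> (\<forall>x\<in>U. \<forall>g\<in>carrier G. E (act g x, act g z))"
proof -
  from E obtain J \<epsilon> where J: "finite J" "J \<subseteq> WAP G act" "\<epsilon> > 0"
    and EJ: "\<And>x y. x \<in> Y \<Longrightarrow> y \<in> Y \<Longrightarrow> (\<forall>f\<in>J. \<bar>f x - f y\<bar> < \<epsilon>) \<Longrightarrow> E (x, y)"
    unfolding eventually_function_uniformity by blast
  from WAP_finite_equicontinuous_on_orbit_closure[OF J, of z]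
  obtain V where V: "open V" "z \<in> V"
    "\<And>f g x. f \<in> J \<Longrightarrow> g \<in> carrier G \<Longrightarrow> x \<in> V \<inter> closure (orbit G act z)
      \<Longrightarrow> \<bar>f (act g x) - f (act g z)\<bar> < \<epsilon>"
    by metis
  have "E (act g x, act g z)" if "x \<in> Z \<inter> (V \<inter> W)" "g \<in> carrier G" for x g
    by (rule EJ) (use that Z z sub V(3) in \<open>auto simp: invariant_subset_def\<close>)
  moreover have "openin (top_of_set Z) (Z \<inter> (V \<inter> W))"
    using V(1) sub(1) by (intro openin_open_Int open_Int)
  ultimately show ?thesis using V(2) sub(2) z by blast
qed

text \<open>The nonempty relative interior of the orbit closure meets the orbit at some
  \<open>act h z\<close>; pulling it back by \<open>h\<close> gives a neighbourhood of
  \<open>z\<close>, and \<open>inv h\<close> returns its points to the invariant orbit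
  closure.\<close>

lemma quasiminimal_orbit_closure_nhd:
  assumes Y: "invariant_subset G act Y" "quasiminimal G act (top_of_set Y)" and z: "z \<in> Y"
  obtains W where "open W" "z \<in> W" "W \<inter> Y \<subseteq> closure (orbit G act z)"
proof -
  let ?D = "orbit G act z"
  have D: "?D \<subseteq> Y" using Y(1) z by (auto simp: invariant_subset_def orbit_def)
  let ?I = "top_of_set Y interior_of (top_of_set Y closure_of ?D)"
  have "openin (top_of_set Y) ?I" by (rule openin_interior_of)
  then obtain O' where O': "open O'" "?I = Y \<inter> O'" unfolding openin_open by blast
  have cl: "top_of_set Y closure_of ?D = Y \<inter> closure ?D"
    using D by (simp add: closure_of_subtopology Int_absorb1)
  have sub: "Y \<inter> O' \<subseteq> Y \<inter> closure ?D"
    using O'(2) interior_of_subset[of "top_of_set Y"] cl by metis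
  have "?I \<noteq> {}" using Y(2) z by (auto simp: quasiminimal_def)
  then have "O' \<inter> closure ?D \<noteq> {}" using O'(2) sub by blast
  then have "O' \<inter> ?D \<noteq> {}" using open_Int_closure_eq_empty[OF O'(1)] by blast
  then obtain h where h: "h \<in> carrier G" "act h z \<in> O'" by (auto simp: orbit_def)
  show thesis
  proof (rule that[of "act h -` O'"])
    show "open (act h -` O')" by (rule open_vimage[OF O'(1) continuous_act_space[OF h(1)]])
    show "z \<in> act h -` O'" using h by simp
    show "act h -` O' \<inter> Y \<subseteq> closure ?D"
    proof
      fix x assume "x \<in> act h -` O' \<inter> Y"
      then have "act h x \<in> closure ?D"
        using sub Y(1) h(1) by (auto simp: invariant_subset_def)
      then have "act (inv h) (act h x) \<in> closure ?D"
        using h(1) by (intro act_closure_orbit[OF inv_closed])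
      then show "x \<in> closure ?D" by (simp add: act_inv_cancel[OF h(1)])
    qed
  qed
qed

lemma wap_locally_equicontinuous:
  assumes "wap G act"
  shows "locally_equicontinuous_flow G act euclidean"
proof -
  let ?\<mu> = "function_uniformity (WAP G act) UNIV"
  have "equicontinuity_point G act (top_of_set Z) (restrict_uniformity ?\<mu> Z) z"
    if Z: "Z = closure (orbit G act z)" for z Z
    unfolding equicontinuity_point_def
  proof (intro allI impI)
    fix E assume "eventually E (restrict_uniformity ?\<mu> Z)"
    \<comment> \<open>An entourage of the restriction is an entourage of the full uniformity once
      conditioned on \<open>Z \<times> Z\<close>; invariance of the orbit closure discharges the
      condition at the end.\<close>
    then have "eventually (\<lambda>p. p \<in> Z \<times> Z \<longrightarrow> E p) ?\<mu>"
      by (simp add: restrict_uniformity_def eventually_inf_principal)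
    moreover have z: "z \<in> Z" using orbit_refl[of z] closure_subset Z by auto
    ultimately obtain U where U: "openin (top_of_set Z) U" "z \<in> U"
      "\<forall>x\<in>U. \<forall>g\<in>carrier G. (act g x, act g z) \<in> Z \<times> Z \<longrightarrow> E (act g x, act g z)"
      using WAP_uniformity_equicontinuity_point[of Z UNIV UNIV z "\<lambda>p. p \<in> Z \<times> Z \<longrightarrow> E p"] Z
      unfolding invariant_subset_def by blast
    have "U \<subseteq> Z" using U(1) openin_imp_subset by blast
    with U z show "\<exists>U. openin (top_of_set Z) U \<and> z \<in> U \<and>
        (\<forall>x\<in>U. \<forall>g\<in>carrier G. E (act g x, act g z))"
      using act_closure_orbit Z by (metis SigmaI subsetD)
  qed
  moreover have "compatible_uniformity euclidean ?\<mu>"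
    using compatible_function_uniformity[of "WAP G act" UNIV] assms
    by (simp add: wap_def)
  ultimately show ?thesis
    unfolding locally_equicontinuous_flow_def Let_def by auto
qed

text \<open>Near \<open>z\<close> the subflow lies inside the orbit closure of \<open>z\<close>, so
  equicontinuity there is equicontinuity in \<open>Y\<close>.\<close>

lemma wap_quasiminimal_equicontinuous:
  assumes "wap G act" and Y: "invariant_subset G act Y" "quasiminimal G act (top_of_set Y)"
  shows "equicontinuous_flow G act (top_of_set Y)"
proof -
  have "equicontinuity_point G act (top_of_set Y) (function_uniformity (WAP G act) Y) z"
    if z: "z \<in> Y" for z
    using quasiminimal_orbit_closure_nhd[OF Y z]
      WAP_uniformity_equicontinuity_point[OF order_refl Y(1) _ _ _ z]
    unfolding equicontinuity_point_def by metis
  moreover have "compatible_uniformity (top_of_set Y) (function_uniformity (WAP G act) Y)"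
    using compatible_function_uniformity assms(1) by (simp add: wap_def)
  ultimately show ?thesis
    unfolding equicontinuous_flow_def by auto
qed

end

theorem corollary6p11:
  fixes G :: "('g, 'm) monoid_scheme"
    and TG :: "'g topology"
    and act :: "'g \<Rightarrow> 'x::topological_space \<Rightarrow> 'x"
  assumes "flow G TG act"
    and "wap G act"
  shows "locally_equicontinuous_flow G act (euclidean :: 'x topology) \<and>
    (\<forall>Y. invariant_subset G act Y \<and> quasiminimal G act (top_of_set Y) \<longrightarrow>
       equicontinuous_flow G act (top_of_set Y))"
  using flow.wap_locally_equicontinuous[OF assms] flow.wap_quasiminimal_equicontinuous[OF assms]
  by blast

end
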